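(* Let $H$ be a bipartite graph of order $m$ with a fixed bipartition $(X,Y)$ of its vertex set, let $H^\tau$ be an orientation of $H$, and suppose the skew-eigenvalues of $H^\tau$ are the non-zero values $\pm\mu_1 i,\pm\mu_2 i,\dots,\pm\mu_t i$ together with $m-2t$ zeros. Let $G^\sigma$ be an oriented graph of order $n$ whose skew-eigenvalues are the non-zero values $\pm\lambda_1 i,\pm\lambda_2 i,\dots,\pm\lambda_r i$ together with $n-2r$ zeros. Then the skew-eigenvalues of the oriented graph $(H^\tau\otimes G^\sigma)^o$ are $\pm\mu_j\lambda_k i$, each with multiplicity $2$, for $j=1,\dots,t$ and $k=1,\dots,r$, and $0$ with multiplicity $mn-4rt$.
   Context: For an oriented graph $D$ on vertices $w_1,\dots,w_N$, its skew-adjacency matrix $S(D)=[s_{ab}]$ has $s_{ab}=1$, $s_{ba}=-1$ if $\langle w_a,w_b\rangle$ is an arc of $D$, and $s_{ab}=s_{ba}=0$ otherwise. The skew-eigenvalues (skew-spectrum) of $D$ are the eigenvalues of $S(D)$, counted with multiplicity; they are purely imaginary or $0$. The Kronecker product $H\otimes G$ has vertex set $V(H)\times V(G)$, with $(u_1,v_1)$ adjacent to $(u_2,v_2)$ iff $u_1u_2\in E(H)$ and $v_1v_2\in E(G)$. The orientation $(H^\tau\otimes G^\sigma)^o$ of $H\otimes G$ is defined as follows: for adjacent $(u_1,v_1),(u_2,v_2)$ with $u_1\in X$ (so $u_2\in Y$), there is an arc from $(u_1,v_1)$ to $(u_2,v_2)$ if either ($\langle u_1,u_2\rangle$ is an arc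 of $H^\tau$ and $\langle v_1,v_2\rangle$ is an arc of $G^\sigma$) or ($\langle u_2,u_1\rangle$ is an arc of $H^\tau$ and $\langle v_2,v_1\rangle$ is an arc of $G^\sigma$); otherwise there is an arc from $(u_2,v_2)$ to $(u_1,v_1)$. *)

theory Defs
  imports
    "Graph_Theory.Pair_Digraph"
    "Jordan_Normal_Form.Char_Poly"
    "HOL-Computational_Algebra.Fundamental_Theorem_Algebra"
begin

text \<open>
  As in the Graph_Theory library, a finite simple graph is a symmetric loop-free digraph
  (\<^locale>\<open>pair_graph\<close>), so an edge \<open>uv\<close> contributes both \<open>(u, v)\<close> and \<open>(v, u)\<close> to
  \<^const>\<open>parcs\<close>.
\<close>

definition bipartition :: "'a set \<Rightarrow> 'a set \<Rightarrow> 'a pair_pre_digraph \<Rightarrow> bool" where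
  "bipartition X Y H \<longleftrightarrow>
     X \<union> Y = pverts H \<and> X \<inter> Y = {} \<and> parcs H \<subseteq> X \<times> Y \<union> Y \<times> X"

definition orientation_of :: "'a pair_pre_digraph \<Rightarrow> 'a pair_pre_digraph \<Rightarrow> bool" where
  "orientation_of D G \<longleftrightarrow>
     pverts D = pverts G \<and> parcs D \<union> (parcs D)\<inverse> = parcs G \<and> parcs D \<inter> (parcs D)\<inverse> = {}"

definition kronecker_graph ::
  "'a pair_pre_digraph \<Rightarrow> 'b pair_pre_digraph \<Rightarrow> ('a \<times> 'b) pair_pre_digraph" where
  "kronecker_graph H G =
     \<lparr> pverts = pverts H \<times> pverts G,
       parcs = {((u1, v1), (u2, v2)) | u1 v1 u2 v2. (u1, u2) \<in> parcs H \<and> (v1, v2) \<in> parcs G} \<rparr>"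

definition same_direction ::
  "'a pair_pre_digraph \<Rightarrow> 'b pair_pre_digraph \<Rightarrow> 'a \<times> 'b \<Rightarrow> 'a \<times> 'b \<Rightarrow> bool" where
  "same_direction H\<tau> G\<sigma> p q \<longleftrightarrow>
     (fst p, fst q) \<in> parcs H\<tau> \<and> (snd p, snd q) \<in> parcs G\<sigma> \<or>
     (fst q, fst p) \<in> parcs H\<tau> \<and> (snd q, snd p) \<in> parcs G\<sigma>"

text \<open>
  In both sets below \<open>p\<close> is the end of the edge \<open>pq\<close> whose first coordinate lies in \<open>X\<close>.
\<close>

definition kronecker_orientation ::
  "'a set \<Rightarrow> 'a pair_pre_digraph \<Rightarrow> 'a pair_pre_digraph \<Rightarrow>
   'b pair_pre_digraph \<Rightarrow> 'b pair_pre_digraph \<Rightarrow> ('a \<times> 'b) pair_pre_digraph" where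
  "kronecker_orientation X H H\<tau> G G\<sigma> =
     \<lparr> pverts = pverts (kronecker_graph H G),
       parcs =
         {(p, q) | p q. (p, q) \<in> parcs (kronecker_graph H G) \<and> fst p \<in> X \<and>
                        same_direction H\<tau> G\<sigma> p q} \<union>
         {(q, p) | p q. (p, q) \<in> parcs (kronecker_graph H G) \<and> fst p \<in> X \<and>
                        \<not> same_direction H\<tau> G\<sigma> p q} \<rparr>"

lemma pair_graph_symD: "pair_graph G \<Longrightarrow> (u, v) \<in> parcs G \<Longrightarrow> (v, u) \<in> parcs G"
  using pair_sym_digraph.pair_sym_arcs[of G]
  by (auto simp: pair_graph_def pair_pseudo_graph_def symmetric_def dest: symD)

lemma orientation_of_kronecker_orientation:
  assumes "pair_graph H" and "pair_graph G" and "bipartition X Y H"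
  shows "orientation_of (kronecker_orientation X H H\<tau> G G\<sigma>) (kronecker_graph H G)"
proof -
  let ?K = "kronecker_graph H G" and ?O = "kronecker_orientation X H H\<tau> G G\<sigma>"
  have sym: "(q, p) \<in> parcs ?K" if "(p, q) \<in> parcs ?K" for p q
    using that assms(1,2)[THEN pair_graph_symD] by (auto simp: kronecker_graph_def)
  have side: "fst p \<in> X \<longleftrightarrow> fst q \<notin> X" if "(p, q) \<in> parcs ?K" for p q
    using that assms(3) by (fastforce simp: kronecker_graph_def bipartition_def)
  have mem: "(p, q) \<in> parcs ?O \<longleftrightarrow>
      (p, q) \<in> parcs ?K \<and> fst p \<in> X \<and> same_direction H\<tau> G\<sigma> p q \<or>
      (q, p) \<in> parcs ?K \<and> fst q \<in> X \<and> \<not> same_direction H\<tau> G\<sigma> q p" for p q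
    unfolding kronecker_orientation_def pair_pre_digraph.simps by blast
  have "e \<in> parcs ?O \<union> (parcs ?O)\<inverse> \<longleftrightarrow> e \<in> parcs ?K" for e
  proof -
    obtain p q where e: "e = (p, q)"
      by (rule prod.exhaust)
    show ?thesis
      using sym[of p q] sym[of q p] side[of p q] mem[of p q] mem[of q p]
      unfolding e Un_iff converse_iff by blast
  qed
  then have "parcs ?O \<union> (parcs ?O)\<inverse> = parcs ?K"
    by blast
  moreover have "(p, q) \<notin> parcs ?O \<inter> (parcs ?O)\<inverse>" for p q
    using side[of p q] side[of q p] mem[of p q] mem[of q p]
    unfolding Int_iff converse_iff by blast
  then have "parcs ?O \<inter> (parcs ?O)\<inverse> = {}"
    by auto
  ultimately show ?thesis
    by (simp add: orientation_of_def kronecker_orientation_def)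
qed

definition enumerates :: "'a list \<Rightarrow> 'a pair_pre_digraph \<Rightarrow> bool" where
  "enumerates ws D \<longleftrightarrow> distinct ws \<and> set ws = pverts D"

definition skew_adjacency_matrix :: "'a list \<Rightarrow> 'a pair_pre_digraph \<Rightarrow> complex mat" where
  "skew_adjacency_matrix ws D =
     mat (length ws) (length ws)
       (\<lambda>(a, b). if (ws ! a, ws ! b) \<in> parcs D then 1
                 else if (ws ! b, ws ! a) \<in> parcs D then -1
                 else 0)"

text \<open>
  The eigenvalues with their algebraic multiplicities; the multiset has size \<open>length ws\<close>.
\<close>

definition skew_spectrum :: "'a list \<Rightarrow> 'a pair_pre_digraph \<Rightarrow> complex multiset" where
  "skew_spectrum ws D = proots (char_poly (skew_adjacency_matrix ws D))"

lemma size_skew_spectrum: "size (skew_spectrum ws D) = length ws"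
proof -
  have "skew_adjacency_matrix ws D \<in> carrier_mat (length ws) (length ws)"
    by (simp add: skew_adjacency_matrix_def)
  then show ?thesis
    by (simp add: skew_spectrum_def size_proots_complex degree_monic_char_poly)
qed

end

theory Submission
  imports Defs "Jordan_Normal_Form.Schur_Decomposition"
begin

text \<open>
  Let \<open>S\<close> and \<open>T\<close> be the skew-adjacency matrices of \<open>H\<tau>\<close> and \<open>G\<sigma>\<close>. In the product orientation the
  entry at \<open>((u1, v1), (u2, v2))\<close> is \<open>S u1 u2 * T v1 v2\<close> if \<open>u1 \<in> X\<close> and \<open>- S u1 u2 * T v1 v2\<close>
  if \<open>u1 \<in> Y\<close>. As \<open>S\<close> only connects \<open>X\<close> with \<open>Y\<close>, conjugating by the diagonal matrix with entries
  \<open>1\<close> over \<open>X\<close> and \<open>\<i>\<close> over \<open>Y\<close> turns this matrix into \<open>\<i>\<close> times the Kronecker product of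
  \<open>S\<close> and \<open>T\<close>. By Schur triangularisation the spectrum of a Kronecker product consists of the
  products of the eigenvalues, and \<open>\<i> * (\<plusminus>\<mu> * \<i>) * (\<plusminus>\<lambda> * \<i>) = \<plusminus>\<mu> * \<lambda> * \<i>\<close>, where each sign
  arises twice.
\<close>

section \<open>Kronecker products\<close>

text \<open>Index \<open>i\<close> encodes the pair of its quotient and remainder by the size of
  \<open>B\<close>. This lexicographic order is also that of \<open>List.product\<close>, so pairs
  of vertices can be enumerated to match.\<close>

definition kron :: "'a :: semiring_1 mat \<Rightarrow> 'a mat \<Rightarrow> 'a mat" where
  "kron A B = mat (dim_row A * dim_row B) (dim_col A * dim_col B)
     (\<lambda>(i, j). A $$ (i div dim_row B, j div dim_col B) * B $$ (i mod dim_row B, j mod dim_col B))"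

lemma kron_carrier_mat [simp, intro]:
  "A \<in> carrier_mat m n \<Longrightarrow> B \<in> carrier_mat p q \<Longrightarrow> kron A B \<in> carrier_mat (m * p) (n * q)"
  by (auto simp: kron_def)

lemma div_less_mult: "i < m * n \<Longrightarrow> i div n < m" for i m n :: nat
  by (simp add: less_mult_imp_div_less)

lemma mod_less_mult: "i < m * n \<Longrightarrow> i mod n < n" for i m n :: nat
  by (cases "n = 0") auto

lemma sum_div_mod:
  fixes h :: "nat \<Rightarrow> nat \<Rightarrow> 'a :: comm_monoid_add"
  shows "(\<Sum>k = 0..<m * n. h (k div n) (k mod n)) = (\<Sum>i = 0..<m. \<Sum>j = 0..<n. h i j)"
proof -
  have less: "i * n + j < m * n" if "i < m" "j < n" for i j
  proof -
    have "i * n + j < Suc i * n" using that by simp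
    also have "\<dots> \<le> m * n" using that by (intro mult_le_mono1) simp
    finally show ?thesis .
  qed
  have "(\<Sum>k = 0..<m * n. h (k div n) (k mod n)) = (\<Sum>(i, j) \<in> {0..<m} \<times> {0..<n}. h i j)"
    by (rule sum.reindex_bij_witness[where j = "\<lambda>k. (k div n, k mod n)" and i = "\<lambda>(i, j). i * n + j"])
       (auto simp: div_less_mult dest: mod_less_mult intro: less)
  then show ?thesis
    by (simp add: sum.cartesian_product)
qed

text \<open>Mixed-product rule: the inner index runs over pairs, and after commuting the middle
  factors the double sum splits into a product of two sums.\<close>

lemma kron_mult:
  fixes A B C D :: "'a :: comm_semiring_1 mat"
  assumes "A \<in> carrier_mat m n" "C \<in> carrier_mat n k" "B \<in> carrier_mat p q" "D \<in> carrier_mat q l"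
  shows "kron A B * kron C D = kron (A * C) (B * D)"
proof (rule eq_matI)
  fix i j
  assume "i < dim_row (kron (A * C) (B * D))" "j < dim_col (kron (A * C) (B * D))"
  then have i: "i < m * p" and j: "j < k * l"
    using assms by (auto simp: kron_def)
  note ij = div_less_mult[OF i] mod_less_mult[OF i] div_less_mult[OF j] mod_less_mult[OF j]
  have "(kron A B * kron C D) $$ (i, j) =
      (\<Sum>s = 0..<n * q. (A $$ (i div p, s div q) * B $$ (i mod p, s mod q)) *
        (C $$ (s div q, j div l) * D $$ (s mod q, j mod l)))"
    using assms i j by (auto simp: kron_def scalar_prod_def intro!: sum.cong)
  also have "\<dots> = (\<Sum>s = 0..<n. \<Sum>t = 0..<q. (A $$ (i div p, s) * B $$ (i mod p, t)) *
        (C $$ (s, j div l) * D $$ (t, j mod l)))"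
    by (rule sum_div_mod)
  also have "\<dots> = (\<Sum>s = 0..<n. A $$ (i div p, s) * C $$ (s, j div l)) *
      (\<Sum>t = 0..<q. B $$ (i mod p, t) * D $$ (t, j mod l))"
    by (simp add: sum_product mult_ac)
  also have "\<dots> = kron (A * C) (B * D) $$ (i, j)"
    using assms i j ij by (auto simp: kron_def scalar_prod_def)
  finally show "(kron A B * kron C D) $$ (i, j) = kron (A * C) (B * D) $$ (i, j)" .
qed (use assms in \<open>auto simp: kron_def\<close>)

lemma kron_one: "kron (1\<^sub>m m) (1\<^sub>m n) = (1\<^sub>m (m * n) :: 'a :: semiring_1 mat)"
proof (rule eq_matI)
  fix i j
  assume "i < dim_row (1\<^sub>m (m * n) :: 'a mat)" "j < dim_col (1\<^sub>m (m * n) :: 'a mat)"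
  then have i: "i < m * n" and j: "j < m * n" by auto
  have "i div n = j div n \<and> i mod n = j mod n \<longleftrightarrow> i = j"
    by (metis div_mult_mod_eq)
  then show "kron (1\<^sub>m m) (1\<^sub>m n) $$ (i, j) = (1\<^sub>m (m * n) :: 'a mat) $$ (i, j)"
    using i j div_less_mult[OF i] mod_less_mult[OF i] div_less_mult[OF j] mod_less_mult[OF j]
    by (auto simp: kron_def)
qed (auto simp: kron_def)

section \<open>Similarity, triangular form and diagonal of Kronecker products\<close>

lemma similar_mat_wit_kron:
  fixes A B :: "'a :: comm_semiring_1 mat"
  assumes A: "A \<in> carrier_mat m m" and B: "B \<in> carrier_mat n n"
    and "similar_mat_wit A A' P Q" and "similar_mat_wit B B' R S"
  shows "similar_mat_wit (kron A B) (kron A' B') (kron P R) (kron Q S)"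
proof -
  note 1 = similar_mat_witD2[OF A assms(3)] and 2 = similar_mat_witD2[OF B assms(4)]
  show ?thesis
  proof (rule similar_mat_witI[of _ _ "m * n"])
    show "kron P R * kron Q S = 1\<^sub>m (m * n)"
      by (simp add: kron_mult[OF 1(6,7) 2(6,7)] 1(1) 2(1) kron_one)
    show "kron Q S * kron P R = 1\<^sub>m (m * n)"
      by (simp add: kron_mult[OF 1(7,6) 2(7,6)] 1(2) 2(2) kron_one)
    have "kron P R * kron A' B' * kron Q S = kron (P * A') (R * B') * kron Q S"
      by (simp add: kron_mult[OF 1(6,5) 2(6,5)])
    also have "\<dots> = kron A B"
      by (subst kron_mult[of _ m m _ m _ n n _ n]) (use 1 2 in auto)
    finally show "kron A B = kron P R * kron A' B' * kron Q S" by simp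
  qed (use 1 2 in auto)
qed

text \<open>Below the diagonal, the column index has a smaller quotient or a smaller remainder than
  the row index, so one of the two factors is an entry below the diagonal of \<open>A\<close> or
  \<open>B\<close>.\<close>

lemma upper_triangular_kron:
  assumes A: "A \<in> carrier_mat m m" and B: "B \<in> carrier_mat n n"
    and "upper_triangular A" and "upper_triangular B"
  shows "upper_triangular (kron A B)"
proof (rule upper_triangularI)
  fix i j assume ji: "j < i" and "i < dim_row (kron A B)"
  then have i: "i < m * n" and j: "j < m * n" using A B by (auto simp: kron_def)
  have "j div n < i div n \<or> j mod n < i mod n"
  proof (rule ccontr)
    assume "\<not> ?thesis"
    then have "i div n * n + i mod n \<le> j div n * n + j mod n"
      by (intro add_mono mult_le_mono1) auto
    with ji show False by simp
  qed
  then have "A $$ (i div n, j div n) = 0 \<or> B $$ (i mod n, j mod n) = 0"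
    using assms div_less_mult[OF i] mod_less_mult[OF i] by (auto simp: upper_triangular_def)
  then show "kron A B $$ (i, j) = 0"
    using A B i j by (auto simp: kron_def)
qed

lemma diag_mat_kron:
  assumes A: "A \<in> carrier_mat m m" and B: "B \<in> carrier_mat n n"
  shows "diag_mat (kron A B) = map (\<lambda>(a, b). a * b) (List.product (diag_mat A) (diag_mat B))"
  by (rule nth_equalityI)
     (use A B in \<open>auto simp: diag_mat_def kron_def product_nth div_less_mult dest: mod_less_mult\<close>)

section \<open>Spectra\<close>

lemma proots_char_poly_upper_triangular:
  fixes A :: "'a :: field mat"
  assumes "A \<in> carrier_mat n n" and "upper_triangular A"
  shows "proots (char_poly A) = mset (diag_mat A)"
proof -
  have "proots (\<Prod>a\<leftarrow>as. [:- a, 1:]) = mset as" for as :: "'a list"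
  proof (induction as)
    case (Cons a as)
    have "(\<Prod>a\<leftarrow>as. [:- a, 1:]) \<noteq> 0"
      by (auto simp: prod_list_zero_iff)
    with Cons show ?case
      \<comment> \<open>The linear factor must stay unexpanded for \<open>proots_mult\<close> to
        apply.\<close>
      by (simp add: proots_mult del: mult_pCons_left)
  qed simp
  then show ?thesis
    by (simp add: char_poly_upper_triangular[OF assms])
qed

text \<open>The characteristic polynomial splits over the complex numbers, so Schur decomposition
  applies. Spectra with algebraic multiplicity can then be read off diagonals.\<close>

lemma similar_upper_triangular_complex:
  fixes A :: "complex mat"
  assumes A: "A \<in> carrier_mat n n"
  obtains T P Q where "T \<in> carrier_mat n n" "similar_mat_wit A T P Q" "upper_triangular T"
    "proots (char_poly A) = mset (diag_mat T)"
proof -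
  obtain es where "char_poly A = (\<Prod>a\<leftarrow>es. [:- a, 1:])"
    using char_poly_factorized[OF A] by blast
  from schur_decomposition_exists[OF A this]
  obtain T P Q where T: "T \<in> carrier_mat n n" "upper_triangular T" and "similar_mat_wit A T P Q"
    by (auto simp: similar_mat_def)
  moreover from this have "char_poly A = char_poly T"
    by (intro char_poly_similar) (auto simp: similar_mat_def)
  ultimately show thesis
    using that proots_char_poly_upper_triangular[OF T] by metis
qed

lemma proots_char_poly_smult:
  fixes A :: "complex mat"
  assumes A: "A \<in> carrier_mat n n"
  shows "proots (char_poly (c \<cdot>\<^sub>m A)) = image_mset ((*) c) (proots (char_poly A))"
proof -
  obtain T P Q where T: "T \<in> carrier_mat n n" and sim: "similar_mat_wit A T P Q"
    and ut: "upper_triangular T" and spec: "proots (char_poly A) = mset (diag_mat T)"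
    by (rule similar_upper_triangular_complex[OF A])
  have "upper_triangular (c \<cdot>\<^sub>m T)"
    using ut T by (auto simp: upper_triangular_def)
  moreover have "diag_mat (c \<cdot>\<^sub>m T) = map ((*) c) (diag_mat T)"
    using T by (auto simp: diag_mat_def)
  moreover have "char_poly (c \<cdot>\<^sub>m A) = char_poly (c \<cdot>\<^sub>m T)"
    using similar_mat_wit_smult[OF sim] by (intro char_poly_similar) (auto simp: similar_mat_def)
  ultimately show ?thesis
    using T by (simp add: proots_char_poly_upper_triangular[of _ n] spec)
qed

text \<open>Multiset form of the list of products on the diagonal of a Kronecker product. Its
  additivity in each argument later separates the non-zero eigenvalues from the zeros.\<close>

definition mset_mult :: "'a :: times multiset \<Rightarrow> 'a multiset \<Rightarrow> 'a multiset" where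
  "mset_mult M N = (\<Sum>a\<in>#M. image_mset ((*) a) N)"

lemma mset_map_mult_product:
  "mset (map (\<lambda>(a, b). a * b) (List.product xs ys)) = mset_mult (mset xs) (mset ys)"
  by (induction xs) (simp_all add: mset_mult_def o_def multiset.map_comp)

lemma proots_char_poly_kron:
  fixes A B :: "complex mat"
  assumes A: "A \<in> carrier_mat m m" and B: "B \<in> carrier_mat n n"
  shows "proots (char_poly (kron A B)) = mset_mult (proots (char_poly A)) (proots (char_poly B))"
proof -
  obtain T P Q where T: "T \<in> carrier_mat m m" and simA: "similar_mat_wit A T P Q"
    and utT: "upper_triangular T" and specA: "proots (char_poly A) = mset (diag_mat T)"
    by (rule similar_upper_triangular_complex[OF A])
  obtain U R S where U: "U \<in> carrier_mat n n" and simB: "similar_mat_wit B U R S"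
    and utU: "upper_triangular U" and specB: "proots (char_poly B) = mset (diag_mat U)"
    by (rule similar_upper_triangular_complex[OF B])
  have "char_poly (kron A B) = char_poly (kron T U)"
    using similar_mat_wit_kron[OF A B simA simB]
    by (intro char_poly_similar) (auto simp: similar_mat_def)
  also have "proots \<dots> = mset (diag_mat (kron T U))"
    by (rule proots_char_poly_upper_triangular[OF kron_carrier_mat[OF T U]
          upper_triangular_kron[OF T U utT utU]])
  finally show ?thesis
    by (simp add: diag_mat_kron[OF T U] mset_map_mult_product specA specB del: mset_map)
qed

section \<open>Matrices indexed by enumerations\<close>

text \<open>The lists only fix an order of rows and columns, so matrix identities reduce to
  identities between functions of vertices.\<close>

definition indexed_mat :: "'a list \<Rightarrow> 'b list \<Rightarrow> ('a \<Rightarrow> 'b \<Rightarrow> 'c) \<Rightarrow> 'c mat" where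
  "indexed_mat xs ys f = mat (length xs) (length ys) (\<lambda>(i, j). f (xs ! i) (ys ! j))"

lemma indexed_mat_carrier [simp]: "indexed_mat xs ys f \<in> carrier_mat (length xs) (length ys)"
  by (simp add: indexed_mat_def)

lemma indexed_mat_cong:
  "(\<And>x y. x \<in> set xs \<Longrightarrow> y \<in> set ys \<Longrightarrow> f x y = g x y) \<Longrightarrow> indexed_mat xs ys f = indexed_mat xs ys g"
  by (rule eq_matI) (auto simp: indexed_mat_def)

lemma indexed_mat_mult:
  assumes "distinct ys"
  shows "indexed_mat xs ys f * indexed_mat ys zs g =
    indexed_mat xs zs (\<lambda>x z. \<Sum>y\<in>set ys. f x y * g y z)"
proof (rule eq_matI)
  fix i j
  assume "i < dim_row (indexed_mat xs zs (\<lambda>x z. \<Sum>y\<in>set ys. f x y * g y z))"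
    "j < dim_col (indexed_mat xs zs (\<lambda>x z. \<Sum>y\<in>set ys. f x y * g y z))"
  then have ij: "i < length xs" "j < length zs" by (auto simp: indexed_mat_def)
  have "(\<Sum>k = 0..<length ys. f (xs ! i) (ys ! k) * g (ys ! k) (zs ! j)) =
      (\<Sum>y\<in>set ys. f (xs ! i) y * g y (zs ! j))"
    by (rule sum.reindex_bij_betw) (simp add: bij_betw_nth assms atLeast0LessThan)
  then show "(indexed_mat xs ys f * indexed_mat ys zs g) $$ (i, j) =
      indexed_mat xs zs (\<lambda>x z. \<Sum>y\<in>set ys. f x y * g y z) $$ (i, j)"
    using ij by (simp add: indexed_mat_def scalar_prod_def)
qed (auto simp: indexed_mat_def)

lemma indexed_mat_one:
  "distinct xs \<Longrightarrow> indexed_mat xs xs (\<lambda>x y. if x = y then 1 else 0) = 1\<^sub>m (length xs)"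
  by (rule eq_matI) (auto simp: indexed_mat_def nth_eq_iff_index_eq)

text \<open>The witness \<open>?P\<close> is a diagonal scaling by \<open>e\<close> whose rows
  follow \<open>xs\<close> and whose columns follow \<open>ys\<close>; one similarity thus rescales
  and reorders. The last assumption says entrywise that the scaling intertwines \<open>f\<close> and
  \<open>g\<close>.\<close>

lemma similar_indexed_mat:
  fixes f g :: "'a \<Rightarrow> 'a \<Rightarrow> 'b :: field" and e :: "'a \<Rightarrow> 'b"
  assumes xs: "distinct xs" and ys: "distinct ys" and set: "set xs = set ys"
    and e: "\<And>x. x \<in> set xs \<Longrightarrow> e x \<noteq> 0"
    and fg: "\<And>x y. x \<in> set xs \<Longrightarrow> y \<in> set xs \<Longrightarrow> f x y * e y = e x * g x y"
  shows "similar_mat (indexed_mat xs xs f) (indexed_mat ys ys g)"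
proof -
  let ?p = "\<lambda>x y. if x = y then e x else 0" and ?q = "\<lambda>x y. if x = y then inverse (e x) else 0"
  let ?P = "indexed_mat xs ys ?p" and ?Q = "indexed_mat ys xs ?q"
  have len: "length xs = length ys"
    using distinct_card[OF xs] distinct_card[OF ys] set by simp
  \<comment> \<open>Moving factors inside the conditionals lets the sums against \<open>?p\<close>
    and \<open>?q\<close> collapse to a single term.\<close>
  have if_mult: "(if b then c else 0) * d = (if b then c * d else 0)"
    "d * (if b then c else 0) = (if b then d * c else 0)" for b and c d :: 'b
    by auto
  have PQ: "?P * ?Q = 1\<^sub>m (length xs)"
    unfolding indexed_mat_mult[OF ys] indexed_mat_one[OF xs, symmetric]
    by (rule indexed_mat_cong) (use set e in \<open>auto simp: if_mult\<close>)
  have QP: "?Q * ?P = 1\<^sub>m (length xs)"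
    unfolding indexed_mat_mult[OF xs] len indexed_mat_one[OF ys, symmetric]
    by (rule indexed_mat_cong) (use set e in \<open>auto simp: if_mult\<close>)
  have "?P * indexed_mat ys ys g * ?Q = indexed_mat xs xs f"
    unfolding indexed_mat_mult[OF ys]
  proof (rule indexed_mat_cong)
    fix x z assume xz: "x \<in> set xs" "z \<in> set xs"
    have "(\<Sum>y\<in>set ys. (\<Sum>y'\<in>set ys. ?p x y' * g y' y) * ?q y z) = e x * g x z * inverse (e z)"
      using xz set by (simp add: if_mult)
    also have "\<dots> = f x z"
      using fg[OF xz] e[OF xz(2)] by (simp flip: fg[OF xz])
    finally show "(\<Sum>y\<in>set ys. (\<Sum>y'\<in>set ys. ?p x y' * g y' y) * ?q y z) = f x z" .
  qed
  then show ?thesis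
    using PQ QP len
    by (intro similar_matI[of _ _ ?P ?Q "length xs"]) (auto simp: indexed_mat_def)
qed

lemma kron_indexed_mat:
  "kron (indexed_mat xs xs f) (indexed_mat ys ys g) =
    indexed_mat (List.product xs ys) (List.product xs ys) (\<lambda>p q. f (fst p) (fst q) * g (snd p) (snd q))"
proof (rule eq_matI)
  let ?R = "indexed_mat (List.product xs ys) (List.product xs ys)
    (\<lambda>p q. f (fst p) (fst q) * g (snd p) (snd q))"
  fix i j assume "i < dim_row ?R" "j < dim_col ?R"
  then have i: "i < length xs * length ys" and j: "j < length xs * length ys"
    by (simp_all add: indexed_mat_def)
  then show "kron (indexed_mat xs xs f) (indexed_mat ys ys g) $$ (i, j) = ?R $$ (i, j)"
    using div_less_mult[OF i] mod_less_mult[OF i] div_less_mult[OF j] mod_less_mult[OF j]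
    by (simp add: kron_def indexed_mat_def product_nth)
qed (simp_all add: kron_def indexed_mat_def)

section \<open>The product orientation\<close>

definition arc_sign :: "'a pair_pre_digraph \<Rightarrow> 'a \<Rightarrow> 'a \<Rightarrow> complex" where
  "arc_sign D x y = (if (x, y) \<in> parcs D then 1 else if (y, x) \<in> parcs D then -1 else 0)"

lemma skew_adjacency_matrix_indexed_mat:
  "skew_adjacency_matrix ws D = indexed_mat ws ws (arc_sign D)"
  by (simp add: skew_adjacency_matrix_def indexed_mat_def arc_sign_def)

text \<open>For \<open>u1\<close> in \<open>X\<close> the orientation rule is exactly the product of
  the two signs. Exchanging both endpoints keeps that product but reverses the sign of the oriented
  edge, whence the factor \<open>-1\<close> when \<open>u1\<close> is outside
  \<open>X\<close>.\<close>

lemma arc_sign_kronecker_orientation: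
  assumes "bipartition X Y H"
    and "orientation_of H\<tau> H" and "orientation_of G\<sigma> G"
  shows "arc_sign (kronecker_orientation X H H\<tau> G G\<sigma>) (u1, v1) (u2, v2) =
    (if u1 \<in> X then 1 else -1) * arc_sign H\<tau> u1 u2 * arc_sign G\<sigma> v1 v2"
proof -
  have H: "(a, b) \<in> parcs H \<longleftrightarrow> (a, b) \<in> parcs H\<tau> \<or> (b, a) \<in> parcs H\<tau>"
    "\<not> ((a, b) \<in> parcs H\<tau> \<and> (b, a) \<in> parcs H\<tau>)" for a b
    using assms(2) unfolding orientation_of_def by blast+
  have G: "(a, b) \<in> parcs G \<longleftrightarrow> (a, b) \<in> parcs G\<sigma> \<or> (b, a) \<in> parcs G\<sigma>"
    "\<not> ((a, b) \<in> parcs G\<sigma> \<and> (b, a) \<in> parcs G\<sigma>)" for a b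
    using assms(3) unfolding orientation_of_def by blast+
  have side: "(a, b) \<in> parcs H \<longrightarrow> (a \<in> X \<longleftrightarrow> b \<notin> X)" for a b
    using assms(1) unfolding bipartition_def by blast
  have mem: "((a, b), (c, d)) \<in> parcs (kronecker_orientation X H H\<tau> G G\<sigma>) \<longleftrightarrow>
      (a, c) \<in> parcs H \<and> (b, d) \<in> parcs G \<and> a \<in> X \<and> same_direction H\<tau> G\<sigma> (a, b) (c, d) \<or>
      (c, a) \<in> parcs H \<and> (d, b) \<in> parcs G \<and> c \<in> X \<and> \<not> same_direction H\<tau> G\<sigma> (c, d) (a, b)"
    for a b c d
    by (auto simp: kronecker_orientation_def kronecker_graph_def)
  show ?thesis
    using H(2)[of u1 u2] G(2)[of v1 v2] side[of u1 u2]
    unfolding arc_sign_def mem same_direction_def fst_conv snd_conv H(1) G(1)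
    \<comment> \<open>Antisymmetry of both orientations and the bipartition, supplied as facts, rule
      out the inconsistent combinations.\<close>
    by (cases "u1 \<in> X"; cases "(u1, u2) \<in> parcs H\<tau>"; cases "(u2, u1) \<in> parcs H\<tau>";
        cases "(v1, v2) \<in> parcs G\<sigma>"; cases "(v2, v1) \<in> parcs G\<sigma>"; simp)
qed

lemma skew_spectrum_kronecker_orientation:
  assumes "bipartition X Y H"
    and "orientation_of H\<tau> H" and "orientation_of G\<sigma> G"
    and us: "enumerates us H\<tau>" and vs: "enumerates vs G\<sigma>"
    and ws: "enumerates ws (kronecker_orientation X H H\<tau> G G\<sigma>)"
  shows "skew_spectrum ws (kronecker_orientation X H H\<tau> G G\<sigma>) =
    image_mset ((*) \<i>) (mset_mult (skew_spectrum us H\<tau>) (skew_spectrum vs G\<sigma>))"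
proof -
  let ?K = "kronecker_orientation X H H\<tau> G G\<sigma>"
  let ?us = "List.product us vs"
  let ?g = "\<lambda>p q. \<i> * (arc_sign H\<tau> (fst p) (fst q) * arc_sign G\<sigma> (snd p) (snd q))"
  \<comment> \<open>Across an edge the required relation reads \<open>1 * \<i> = 1 * \<i>\<close>
    from \<open>X\<close> to \<open>Y\<close>, and \<open>-1 * 1 = \<i> * \<i>\<close> from
    \<open>Y\<close> to \<open>X\<close>.\<close>
  let ?e = "\<lambda>p. if fst p \<in> X then 1 else \<i>"
  \<comment> \<open>Within one side the scaling factors agree and cannot turn a sign into
    \<open>\<i>\<close>; there both entries have to vanish.\<close>
  have cross: "arc_sign H\<tau> a b = 0" if "a \<in> X \<longleftrightarrow> b \<in> X" for a b
    using assms(1,2) that unfolding arc_sign_def orientation_of_def bipartition_def by auto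
  have "similar_mat (indexed_mat ws ws (arc_sign ?K)) (indexed_mat ?us ?us ?g)"
  proof (rule similar_indexed_mat[where e = ?e])
    show "distinct ws" "distinct ?us" "set ws = set ?us"
      using us vs ws assms(2,3)
      by (auto simp: enumerates_def distinct_product kronecker_orientation_def kronecker_graph_def
          orientation_of_def)
    fix p q :: "'a \<times> 'b"
    show "arc_sign ?K p q * ?e q = ?e p * ?g p q"
      using cross[of "fst p" "fst q"]
      by (cases p; cases q) (auto simp: arc_sign_kronecker_orientation[OF assms(1-3)])
  qed auto
  moreover have "indexed_mat ?us ?us ?g =
      \<i> \<cdot>\<^sub>m kron (skew_adjacency_matrix us H\<tau>) (skew_adjacency_matrix vs G\<sigma>)"
    unfolding skew_adjacency_matrix_indexed_mat kron_indexed_mat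
    by (rule eq_matI) (auto simp: indexed_mat_def)
  ultimately have "char_poly (skew_adjacency_matrix ws ?K) =
      char_poly (\<i> \<cdot>\<^sub>m kron (skew_adjacency_matrix us H\<tau>) (skew_adjacency_matrix vs G\<sigma>))"
    by (simp add: skew_adjacency_matrix_indexed_mat char_poly_similar)
  moreover have S: "skew_adjacency_matrix us H\<tau> \<in> carrier_mat (length us) (length us)"
    "skew_adjacency_matrix vs G\<sigma> \<in> carrier_mat (length vs) (length vs)"
    by (simp_all add: skew_adjacency_matrix_def)
  ultimately show ?thesis
    by (simp add: skew_spectrum_def proots_char_poly_smult[OF kron_carrier_mat[OF S]]
        proots_char_poly_kron[OF S])
qed

section \<open>Products of multisets\<close>

lemma mset_mult_add_left: "mset_mult (M + M') N = mset_mult M N + mset_mult M' N"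
  by (simp add: mset_mult_def)

lemma mset_mult_add_right: "mset_mult M (N + N') = mset_mult M N + mset_mult M N'"
  by (simp add: mset_mult_def sum_mset.distrib)

lemma mset_mult_sum_left: "mset_mult (\<Sum>j\<in>A. F j) N = (\<Sum>j\<in>A. mset_mult (F j) N)"
  by (induction A rule: infinite_finite_induct)
     (simp_all add: mset_mult_add_left, simp_all add: mset_mult_def)

lemma mset_mult_sum_right: "mset_mult M (\<Sum>j\<in>A. F j) = (\<Sum>j\<in>A. mset_mult M (F j))"
  by (induction A rule: infinite_finite_induct)
     (simp_all add: mset_mult_add_right, simp_all add: mset_mult_def)

lemma replicate_mset_plus: "replicate_mset (k + l) x = replicate_mset k x + replicate_mset l x"
  by (induction k) auto

text \<open>Each zero in one multiset contributes one zero for every element of the other.\<close>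

lemma mset_mult_zeros_left:
  "mset_mult (replicate_mset k 0) N = replicate_mset (k * size N) (0 :: 'a :: mult_zero)"
proof -
  have "image_mset ((*) 0) N = replicate_mset (size N) (0 :: 'a)"
    by (induction N) auto
  then show ?thesis
    by (induction k) (simp_all add: mset_mult_def replicate_mset_plus add.commute)
qed

lemma mset_mult_zeros_right:
  "mset_mult M (replicate_mset k 0) = replicate_mset (size M * k) (0 :: 'a :: mult_zero)"
  by (induction M) (simp_all add: mset_mult_def replicate_mset_plus add.commute)

lemma image_mset_sum: "image_mset f (\<Sum>j\<in>A. F j) = (\<Sum>j\<in>A. image_mset f (F j))"
  by (induction A rule: infinite_finite_induct) auto

lemma image_mset_mult_imaginary_pairs:
  "image_mset ((*) \<i>) (mset_mult {#\<i> * of_real a, - (\<i> * of_real a)#}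
     {#\<i> * of_real b, - (\<i> * of_real b)#}) =
    replicate_mset 2 (\<i> * of_real (a * b)) + replicate_mset 2 (- (\<i> * of_real (a * b)))"
proof -
  \<comment> \<open>Up to sign all four products equal this one: equal signs give this value twice,
    opposite signs its negative twice.\<close>
  have "\<i> * (\<i> * of_real a * (\<i> * of_real b)) = - (\<i> * of_real (a * b))"
    by (simp add: complex_eq_iff)
  then show ?thesis
    by (simp add: mset_mult_def numeral_2_eq_2)
qed

section \<open>Assembling the product spectrum and counting its zeros\<close>

theorem theorem2p1:
  fixes H H\<tau> :: "'a pair_pre_digraph" and G G\<sigma> :: "'b pair_pre_digraph"
    and X Y :: "'a set"
    and us :: "'a list" and vs :: "'b list" and ws :: "('a \<times> 'b) list"
    and m n t r :: nat and mu lam :: "nat \<Rightarrow> real"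
  assumes "pair_graph H" and "card (pverts H) = m" and "bipartition X Y H"
    and "orientation_of H\<tau> H"
    and "pair_graph G" and "card (pverts G) = n"
    and "orientation_of G\<sigma> G"
    and "enumerates us H\<tau>" and "enumerates vs G\<sigma>"
    and "enumerates ws (kronecker_orientation X H H\<tau> G G\<sigma>)"
    and "\<And>j. j \<in> {1..t} \<Longrightarrow> mu j \<noteq> 0"
    and "skew_spectrum us H\<tau> =
           (\<Sum>j = 1..t. {# \<i> * of_real (mu j), - (\<i> * of_real (mu j)) #})
           + replicate_mset (m - 2 * t) 0"
    and "\<And>k. k \<in> {1..r} \<Longrightarrow> lam k \<noteq> 0"
    and "skew_spectrum vs G\<sigma> =
           (\<Sum>k = 1..r. {# \<i> * of_real (lam k), - (\<i> * of_real (lam k)) #})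
           + replicate_mset (n - 2 * r) 0"
  shows "skew_spectrum ws (kronecker_orientation X H H\<tau> G G\<sigma>) =
           (\<Sum>j = 1..t. \<Sum>k = 1..r.
              replicate_mset 2 (\<i> * of_real (mu j * lam k)) +
              replicate_mset 2 (- (\<i> * of_real (mu j * lam k))))
           + replicate_mset (m * n - 4 * r * t) 0"
proof -
  let ?K = "kronecker_orientation X H H\<tau> G G\<sigma>"
  let ?M = "\<Sum>j = 1..t. {# \<i> * of_real (mu j), - (\<i> * of_real (mu j)) #}"
  let ?N = "\<Sum>k = 1..r. {# \<i> * of_real (lam k), - (\<i> * of_real (lam k)) #}"
  let ?R = "\<Sum>j = 1..t. \<Sum>k = 1..r.
              replicate_mset 2 (\<i> * of_real (mu j * lam k)) +
              replicate_mset 2 (- (\<i> * of_real (mu j * lam k)))"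
  have "image_mset ((*) \<i>) (mset_mult ?M ?N) = ?R"
    \<comment> \<open>The bilinear expansion leaves the sum over \<open>k\<close> outermost, so the
      two sums are exchanged.\<close>
    by (simp only: mset_mult_sum_left mset_mult_sum_right image_mset_sum
        image_mset_mult_imaginary_pairs, rule sum.swap)
  \<comment> \<open>The three blocks involving a zero eigenvalue consist of zeros only; they are
    merged under an unspecified count \<open>z\<close>.\<close>
  then obtain z where z: "skew_spectrum ws ?K = ?R + replicate_mset z 0"
    unfolding skew_spectrum_kronecker_orientation[OF assms(3,4,7-10)] assms(12,14)
    by (simp add: mset_mult_add_left mset_mult_add_right mset_mult_zeros_left mset_mult_zeros_right
        add.assoc flip: replicate_mset_plus)
  have "length ws = card (pverts H \<times> pverts G)"
    using assms(10) distinct_card[of ws]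
    by (simp add: enumerates_def kronecker_orientation_def kronecker_graph_def)
  then have "size (skew_spectrum ws ?K) = m * n"
    by (simp add: size_skew_spectrum card_cartesian_product assms(2,6))
  moreover have "size ?R = 4 * r * t"
    by (simp add: size_multiset_sum)
  \<comment> \<open>Comparing sizes gives \<open>m * n = 4 * r * t + z\<close>, so the truncated
    subtraction is exact.\<close>
  ultimately have "z = m * n - 4 * r * t"
    by (simp add: z mult.commute mult.left_commute)
  with z show ?thesis by simp
qed

end
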